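(* Let $d\ge 3$ and $r\in\mathbb{N}$. Then for every $P\in\mathcal{P}^d(r)$, $$v(P)\notin[\,r^{d-1}+1,\ r^{d-1}+r^{d-2}-1\,].$$
   Context: $\mathbb{N}$ denotes the positive integers. Let $e_1,\ldots,e_d$ be the standard basis of $\mathbb{R}^d$. A convex lattice polytope in $\mathbb{R}^d$ is a convex polytope all of whose vertices belong to $\mathbb{Z}^d$ (it need not be full-dimensional). For $r\in\mathbb{N}$ let $A(r)=\mathrm{conv}\{re_1,\ldots,re_d\}$ and $S(r)=\mathrm{conv}(A(r)\cup\{0\})$. Let $\mathcal{P}^d(r)$ be the collection of all convex lattice polytopes $P\subset\mathbb{R}^d$ with $A(r)\subset P\subset S(r)$. For $P\in\mathcal{P}^d(r)$ put $v(P)=d!\,\mathrm{vol}(P)$, where $\mathrm{vol}$ is $d$-dimensional volume; $v(P)$ is an integer with $0\le v(P)\le r^d$. An interval $[a,b]$ with $a>b$ is empty. *)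

theory Defs
  imports "HOL-Analysis.Analysis"
begin

text \<open>
  The dimension \<open>d\<close> is \<open>CARD('d)\<close>, and the standard basis vectors of
  \<open>real ^ 'd\<close> are the vectors \<open>axis i 1\<close>.
\<close>

definition integer_lattice :: "(real ^ 'd) set" where
  "integer_lattice = {x. \<forall>i. x $ i \<in> \<int>}"

text \<open>The vertices of a polytope are its extreme points; \<open>P\<close> need not be full-dimensional.\<close>

definition lattice_polytope :: "(real ^ 'd) set \<Rightarrow> bool" where
  "lattice_polytope P \<longleftrightarrow> polytope P \<and> {x. x extreme_point_of P} \<subseteq> integer_lattice"

definition A_simplex :: "nat \<Rightarrow> (real ^ 'd) set" where
  "A_simplex r = convex hull (range (\<lambda>i. real r *\<^sub>R axis i 1))"

definition S_simplex :: "nat \<Rightarrow> (real ^ 'd) set" where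
  "S_simplex r = convex hull (A_simplex r \<union> {0})"

definition polytopes_between :: "nat \<Rightarrow> (real ^ 'd) set set" where
  "polytopes_between r = {P. lattice_polytope P \<and> A_simplex r \<subseteq> P \<and> P \<subseteq> S_simplex r}"

definition normalized_volume :: "(real ^ 'd) set \<Rightarrow> real" where
  "normalized_volume P = fact CARD('d) * measure lebesgue P"

end

theory Submission
  imports Defs
begin

text \<open>
  Call \<open>r - (x\<^sub>1 + \<dots> + x\<^sub>d)\<close> the height of a point \<open>x\<close>: it is the lattice distance from the
  hyperplane of \<open>A(r)\<close>, so it is a natural number at every vertex of \<open>P\<close>.  The pyramid over \<open>A(r)\<close>
  with apex \<open>x\<close> has normalized volume \<open>height(x) * r ^ (d - 1)\<close>, and \<open>P\<close> contains it for each of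
  its vertices \<open>x\<close>.  This leaves three cases.

  \<^item> If some vertex has height at least \<open>2\<close>, then \<open>v(P) \<ge> 2 r ^ (d - 1)\<close>, which is at or above
    \<open>r ^ (d - 1) + r ^ (d - 2)\<close>.
  \<^item> If all vertices but one lie in \<open>A(r)\<close> and the remaining one has height at most \<open>1\<close>, then \<open>P\<close> is
    contained in a single pyramid and \<open>v(P) \<le> r ^ (d - 1)\<close>.
  \<^item> If two different vertices \<open>x\<close> and \<open>y\<close> have height \<open>1\<close>, their coordinate sums agree, so
    \<open>y\<^sub>i < x\<^sub>i\<close> for some \<open>i\<close>.  Then \<open>y\<close> lies beyond the facet of the pyramid with apex \<open>x\<close> that omits
    the corner \<open>r e\<^sub>i\<close>, and the simplex spanned by this facet and \<open>y\<close> adds normalized volume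
    \<open>(x\<^sub>i - y\<^sub>i) r ^ (d - 2) \<ge> r ^ (d - 2)\<close>.

  Both volumes come from one principle, \<open>measure_pyramid_move_apex\<close>: for a fixed base lying in a
  hyperplane, the volume of a pyramid is proportional to the distance of its apex from that
  hyperplane.  The first pyramid is compared with \<open>S(r)\<close>, whose apex is the origin; the extra simplex
  is compared with the first pyramid, seen as having apex \<open>r e\<^sub>i\<close>.
\<close>

section \<open>Well-ordering a finite index type\<close>

text \<open>
  The formula for the volume of a linear image, \<open>measure_linear_image\<close>, is stated for
  coordinates indexed by a well-ordered finite type, whereas the dimension of the theorem is given by
  an arbitrary finite type.  The remedy is a copy of the index type that carries the order of an
  enumeration; the resulting renaming of coordinates preserves inner products and Lebesgue
  measure.
\<close>

typedef 'a ranked = "UNIV :: 'a set"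
  morphisms unranked ranked by simp

lemmas ranked_inverses [simp] = ranked_inverse [OF UNIV_I] unranked_inverse

lemma bij_ranked: "bij ranked"
  by (intro o_bij [of unranked]) (auto simp: fun_eq_iff)

instance ranked :: (finite) finite
proof
  have "(UNIV :: 'a ranked set) = range ranked"
    using bij_ranked by (auto simp: bij_def)
  then show "finite (UNIV :: 'a ranked set)"
    by (metis finite finite_imageI)
qed

instantiation ranked :: (finite) wellorder
begin

definition "x \<le> y \<longleftrightarrow> to_nat (unranked x) \<le> to_nat (unranked y)"

definition "x < y \<longleftrightarrow> to_nat (unranked x) < to_nat (unranked y)"

instance
proof
  fix P :: "'a ranked \<Rightarrow> bool" and a
  assume step: "\<And>x. (\<And>y. y < x \<Longrightarrow> P y) \<Longrightarrow> P x"
  show "P a"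
  proof (induction a rule: measure_induct_rule [where f = "\<lambda>x. to_nat (unranked x)"])
    case (less x)
    show ?case
      by (rule step, rule less) (simp add: less_ranked_def)
  qed
qed (auto simp: less_eq_ranked_def less_ranked_def unranked_inject)

end

definition relabel :: "real ^ 'n \<Rightarrow> real ^ 'n ranked" where
  "relabel x = (\<chi> i. x $ unranked i)"

lemma linear_relabel: "linear relabel"
  by (rule linearI) (simp_all add: relabel_def vec_eq_iff)

lemma inner_relabel [simp]: "relabel x \<bullet> relabel y = x \<bullet> y"
proof -
  have "(\<Sum>i\<in>UNIV. x $ unranked i * y $ unranked i) = (\<Sum>j\<in>UNIV. x $ j * y $ j)"
    by (rule sum.reindex_bij_witness [of _ ranked unranked]) auto
  then show ?thesis
    by (simp add: relabel_def inner_vec_def)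
qed

lemma relabel_axis: "relabel (axis j c) = axis (ranked j) c"
  by (auto simp: relabel_def axis_def vec_eq_iff)

lemma bij_relabel: "bij relabel"
  by (intro o_bij [of "\<lambda>y. \<chi> j. y $ ranked j"]) (auto simp: fun_eq_iff relabel_def)

lemma Basis_eq_range_axis: "(Basis :: (real ^ 'n) set) = range (\<lambda>i. axis i 1)"
  by (auto simp: Basis_vec_def)

lemma bij_betw_relabel_Basis: "bij_betw relabel Basis Basis"
proof -
  have "relabel ` range (\<lambda>j. axis j 1) = (\<lambda>i. axis i 1) ` range ranked"
    by (simp add: image_image relabel_axis)
  also have "range ranked = UNIV"
    using bij_ranked by (rule bij_is_surj)
  finally have "relabel ` Basis = Basis"
    by (simp only: Basis_eq_range_axis)
  then show ?thesis
    using bij_relabel by (auto simp: bij_betw_def intro: inj_on_subset)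
qed

text \<open>The preimage of a box under a renaming of coordinates is a box with the same side lengths.\<close>

lemma lborel_eq_distr_relabel: "(lborel :: (real ^ 'n::finite ranked) measure) = distr lborel borel relabel"
proof (rule lborel_eqI)
  fix l u :: "real ^ 'n ranked"
  assume le: "\<And>b. b \<in> Basis \<Longrightarrow> l \<bullet> b \<le> u \<bullet> b"
  obtain l' u' where lu: "l = relabel l'" "u = relabel u'"
    using bij_relabel [THEN bij_is_surj] by (metis surjD)
  have Basis_eq: "(Basis :: (real ^ 'n ranked) set) = relabel ` Basis"
    using bij_betw_relabel_Basis by (auto simp: bij_betw_def)
  have "relabel \<in> borel_measurable (borel :: (real ^ 'n) measure)"
    by (intro borel_measurable_continuous_onI linear_continuous_on linear_linear [THEN iffD2] linear_relabel)
  then have "emeasure (distr lborel borel relabel) (box l u) = emeasure lborel (relabel -` box l u)"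
    by (subst emeasure_distr) auto
  also have "relabel -` box l u = box l' u'"
    by (auto simp: box_def lu Basis_eq)
  also have "emeasure lborel (box l' u') = (\<Prod>b\<in>Basis. (u' - l') \<bullet> b)"
  proof (rule emeasure_lborel_box)
    fix b :: "real ^ 'n"
    assume "b \<in> Basis"
    then have "relabel b \<in> Basis"
      by (simp add: Basis_eq)
    from le [OF this] show "l' \<bullet> b \<le> u' \<bullet> b"
      by (simp add: lu)
  qed
  also have "(\<Prod>b\<in>Basis. (u' - l') \<bullet> b) = (\<Prod>b\<in>Basis. (u - l) \<bullet> relabel b)"
    by (simp add: lu inner_diff_left)
  also have "\<dots> = (\<Prod>b\<in>Basis. (u - l) \<bullet> b)"
    by (rule prod.reindex_bij_betw [OF bij_betw_relabel_Basis])
  finally show "emeasure (distr lborel borel relabel) (box l u) = (\<Prod>b\<in>Basis. (u - l) \<bullet> b)" .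
qed simp

lemma measure_relabel:
  assumes "compact S"
  shows "measure lebesgue (relabel ` S) = measure lebesgue S"
proof -
  have cont: "continuous_on T relabel" for T :: "(real ^ 'n) set"
    by (intro linear_continuous_on linear_linear [THEN iffD2] linear_relabel)
  have "compact (relabel ` S)"
    using assms cont by (rule compact_continuous_image [rotated])
  then have "measure lebesgue (relabel ` S) = measure lborel (relabel ` S)"
    by (simp add: borel_compact)
  also have "\<dots> = measure lborel (relabel -` relabel ` S)"
    using \<open>compact (relabel ` S)\<close> cont
    by (subst lborel_eq_distr_relabel, subst measure_distr)
       (auto intro: borel_measurable_continuous_onI borel_compact)
  also have "relabel -` relabel ` S = S"
    using bij_relabel [THEN bij_is_inj] by (rule inj_vimage_image_eq)
  finally show ?thesis
    using assms by (simp add: borel_compact)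
qed

section \<open>The volume of a pyramid as a function of its apex\<close>

text \<open>
  Unless \<open>u = 0\<close>, some coordinate \<open>u\<^sub>k\<close> is nonzero, and the matrix \<open>B\<close> that sends \<open>e\<^sub>k\<close> to \<open>u\<close>
  and fixes the other basis vectors is invertible.  It conjugates \<open>I + u v\<^sup>T\<close> into a matrix \<open>N\<close> that
  differs from the identity in row \<open>k\<close> only, and by Cramer's rule the determinant of \<open>N\<close> is its
  \<open>k\<close>-th diagonal entry.
\<close>

lemma det_identity_plus_rank_one:
  fixes u v :: "real ^ 'n"
  shows "det (\<chi> i j. (if i = j then 1 else 0) + u $ i * v $ j) = 1 + v \<bullet> u"
proof (cases "u = 0")
  case True
  then show ?thesis
    using det_I by (simp add: mat_def)
next
  case False
  then obtain k where k: "u $ k \<noteq> 0"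
    by (auto simp: vec_eq_iff)
  let ?M = "\<chi> i j. (if i = j then 1 else 0) + u $ i * v $ j"
  define B :: "real ^ 'n ^ 'n" where "B = (\<chi> i j. if j = k then u $ i else mat 1 $ i $ j)"
  define w where "w = (\<chi> j. if j = k then 1 + v \<bullet> u else v $ j)"
  define N :: "real ^ 'n ^ 'n" where "N = (\<chi> i. if i = k then w else axis i 1)"
  have "det B = u $ k"
    using cramer_lemma [of k "mat 1" u] unfolding B_def matrix_vector_mul_lid by simp
  moreover have "det N = 1 + v \<bullet> u"
  proof -
    have "row i (mat 1) = axis i (1::real)" for i :: 'n
      by (auto simp: row_def mat_def axis_def vec_eq_iff)
    moreover have "(\<Sum>i\<in>UNIV. w $ i *s axis i 1) = w"
      by (simp add: basis_expansion)
    ultimately show ?thesis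
      using cramer_lemma_transpose [of k w "mat 1"] by (simp add: N_def w_def cong: if_cong)
  qed
  moreover have "?M ** B = B ** N"
  proof -
    have "(?M ** B) $ i $ j = (B ** N) $ i $ j" for i j
    proof -
      have "(?M ** B) $ i $ j = B $ i $ j + u $ i * (\<Sum>l\<in>UNIV. v $ l * B $ l $ j)"
        by (simp add: matrix_matrix_mult_def distrib_right sum.distrib sum_distrib_left mult.assoc
            if_distrib [of "\<lambda>c. c * _"] cong: if_cong)
      also have "(\<Sum>l\<in>UNIV. v $ l * B $ l $ j) = (if j = k then v \<bullet> u else v $ j)"
        by (cases "j = k")
          (simp_all add: B_def mat_def inner_vec_def if_distrib [of "\<lambda>c. _ * c"] cong: if_cong)
      also have "B $ i $ j + u $ i * (if j = k then v \<bullet> u else v $ j)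
          = u $ i * w $ j + (\<Sum>l\<in>UNIV - {k}. if i = l then axis i 1 $ j else 0)"
        by (auto simp: B_def w_def mat_def axis_def algebra_simps)
      also have "\<dots> = B $ i $ k * N $ k $ j + (\<Sum>l\<in>UNIV - {k}. B $ i $ l * N $ l $ j)"
        by (intro arg_cong2 [of _ _ _ _ "(+)"] sum.cong refl) (auto simp: B_def N_def mat_def)
      also have "\<dots> = (B ** N) $ i $ j"
        by (simp add: matrix_matrix_mult_def sum.remove [of UNIV k])
      finally show ?thesis .
    qed
    then show ?thesis
      by (simp add: vec_eq_iff)
  qed
  then have "det ?M * det B = det B * det N"
    by (simp only: det_mul [symmetric])
  ultimately show ?thesis
    using k by simp
qed

text \<open>
  The affine function \<open>z \<mapsto> v \<bullet> z - c\<close> vanishes on the base \<open>F\<close>.  The affine map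
  \<open>z \<mapsto> z + (v \<bullet> z - c) w\<close>, where \<open>w = (b - a) / (v \<bullet> a - c)\<close>, therefore fixes \<open>F\<close> pointwise and
  carries the apex \<open>a\<close> to \<open>b\<close>.  Its linear part is the identity plus a matrix of rank one, so its
  determinant is \<open>1 + v \<bullet> w\<close>, which is the ratio of the two heights.
\<close>

lemma measure_pyramid_move_apex_wellorder:
  fixes F :: "(real ^ 'n :: {finite,wellorder}) set"
  assumes "finite F" and F: "\<And>z. z \<in> F \<Longrightarrow> v \<bullet> z = c" and a: "v \<bullet> a \<noteq> c"
  shows "measure lebesgue (convex hull (insert b F))
    = \<bar>(v \<bullet> b - c) / (v \<bullet> a - c)\<bar> * measure lebesgue (convex hull (insert a F))"
proof -
  define w where "w = (1 / (v \<bullet> a - c)) *\<^sub>R (b - a)"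
  define f where "f z = z + (v \<bullet> z) *\<^sub>R w" for z
  have lin: "linear f"
    by (rule linearI) (simp_all add: f_def algebra_simps)
  have "matrix f = (\<chi> i j. (if i = j then 1 else 0) + w $ i * v $ j)"
    by (simp add: matrix_def f_def vec_eq_iff inner_axis) (simp add: axis_def)
  then have "det (matrix f) = 1 + v \<bullet> w"
    by (simp add: det_identity_plus_rank_one)
  also have "v \<bullet> w = (v \<bullet> b - v \<bullet> a) / (v \<bullet> a - c)"
    by (simp add: w_def inner_diff_right)
  also have "1 + \<dots> = (v \<bullet> b - c) / (v \<bullet> a - c)"
    using a by (simp add: field_simps)
  finally have det: "det (matrix f) = (v \<bullet> b - c) / (v \<bullet> a - c)" .
  have fF: "- (c *\<^sub>R w) + f z = z" if "z \<in> F" for z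
    using F [OF that] by (simp add: f_def)
  have fa: "- (c *\<^sub>R w) + f a = b"
  proof -
    have "- (c *\<^sub>R w) + f a = a + (v \<bullet> a - c) *\<^sub>R w"
      by (simp add: f_def algebra_simps)
    then show ?thesis
      using a by (simp add: w_def)
  qed
  have "insert b F = (+) (- (c *\<^sub>R w)) ` f ` insert a F"
    using fF fa by (force simp: image_iff)
  then have "convex hull (insert b F) = (+) (- (c *\<^sub>R w)) ` f ` (convex hull (insert a F))"
    by (simp only: convex_hull_translation convex_hull_linear_image [OF lin])
  moreover have "convex hull (insert a F) \<in> lmeasurable"
    using \<open>finite F\<close> by (intro lmeasurable_compact finite_imp_compact_convex_hull) simp
  ultimately show ?thesis
    by (simp only: measure_translation measure_linear_image [OF lin] det)
qed

lemma measure_pyramid_move_apex: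
  fixes F :: "(real ^ 'n) set"
  assumes "finite F" and F: "\<And>z. z \<in> F \<Longrightarrow> v \<bullet> z = c" and a: "v \<bullet> a \<noteq> c"
  shows "measure lebesgue (convex hull (insert b F))
    = \<bar>(v \<bullet> b - c) / (v \<bullet> a - c)\<bar> * measure lebesgue (convex hull (insert a F))"
proof -
  have eq: "measure lebesgue (convex hull (insert p F))
      = measure lebesgue (convex hull (insert (relabel p) (relabel ` F)))" for p
  proof -
    have "convex hull (insert (relabel p) (relabel ` F)) = relabel ` (convex hull (insert p F))"
      by (simp add: convex_hull_linear_image [OF linear_relabel])
    moreover have "compact (convex hull (insert p F))"
      using \<open>finite F\<close> by (intro finite_imp_compact_convex_hull) simp
    ultimately show ?thesis
      by (simp only: measure_relabel)
  qed
  show ?thesis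
    unfolding eq
    by (subst measure_pyramid_move_apex_wellorder [of "relabel ` F" "relabel v" c "relabel a"])
      (use assms in auto)
qed

text \<open>The two pyramids meet only inside the hyperplane of their common base, a null set.\<close>

lemma measure_pyramids_on_opposite_sides:
  fixes F :: "(real ^ 'n) set"
  assumes "finite F" and F: "\<And>z. z \<in> F \<Longrightarrow> v \<bullet> z = c"
    and a: "v \<bullet> a > c" and b: "v \<bullet> b < c"
  shows "measure lebesgue (convex hull (insert a F) \<union> convex hull (insert b F))
    = measure lebesgue (convex hull (insert a F)) + measure lebesgue (convex hull (insert b F))"
proof -
  have "convex hull (insert a F) \<subseteq> {z. v \<bullet> z \<ge> c}"
    using F a by (intro hull_minimal convex_halfspace_ge) auto
  moreover have "convex hull (insert b F) \<subseteq> {z. v \<bullet> z \<le> c}"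
    using F b by (intro hull_minimal convex_halfspace_le) auto
  ultimately have "convex hull (insert a F) \<inter> convex hull (insert b F) \<subseteq> {z. v \<bullet> z = c}"
    by (auto intro: antisym)
  moreover have "negligible {z. v \<bullet> z = c}"
    using a b by (intro negligible_hyperplane) auto
  ultimately have "negligible (convex hull (insert a F) \<inter> convex hull (insert b F))"
    by (rule negligible_subset [rotated])
  moreover have "convex hull (insert p F) \<in> lmeasurable" for p
    using \<open>finite F\<close> by (intro lmeasurable_compact finite_imp_compact_convex_hull) simp
  ultimately show ?thesis
    by (simp add: measure_Un3 negligible_imp_measure0)
qed

section \<open>The simplices \<open>A(r)\<close> and \<open>S(r)\<close>\<close>

definition corner :: "nat \<Rightarrow> 'd \<Rightarrow> real ^ 'd" where
  "corner r i = real r *\<^sub>R axis i 1"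

lemma A_simplex_eq: "A_simplex r = convex hull (range (corner r))"
  by (simp add: A_simplex_def corner_def [abs_def])

lemma S_simplex_eq: "S_simplex r = convex hull (insert 0 (range (corner r)))"
  unfolding S_simplex_def A_simplex_eq by (metis Un_insert_right hull_Un_left sup_bot.right_neutral)

lemma one_inner: "(1 :: real ^ 'd) \<bullet> z = (\<Sum>i\<in>UNIV. z $ i)"
  by (simp add: inner_vec_def)

lemma one_inner_corner [simp]: "(1 :: real ^ 'd) \<bullet> corner r i = real r"
  by (simp add: corner_def inner_axis)

lemma S_simplex_bounds:
  assumes "z \<in> S_simplex r"
  shows "0 \<le> z $ i" and "1 \<bullet> z \<le> real r"
proof -
  have "S_simplex r \<subseteq> {z. axis i 1 \<bullet> z \<ge> 0} \<inter> {z. 1 \<bullet> z \<le> real r}"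
    unfolding S_simplex_eq
    by (intro hull_minimal convex_Int convex_halfspace_ge convex_halfspace_le)
      (auto simp: inner_axis', simp add: corner_def axis_def)
  with assms show "0 \<le> z $ i" and "1 \<bullet> z \<le> real r"
    by (auto simp: inner_axis')
qed

text \<open>
  A point of \<open>S(r)\<close> on the hyperplane of \<open>A(r)\<close> has the numbers \<open>z\<^sub>i / r\<close> as barycentric coordinates
  with respect to the corners.
\<close>

lemma A_simplex_memI:
  assumes "r > 0" "z \<in> S_simplex r" "1 \<bullet> z = real r"
  shows "z \<in> A_simplex r"
proof -
  have "(\<Sum>i\<in>UNIV. (z $ i / real r) *\<^sub>R corner r i) \<in> convex hull (range (corner r))"
    using assms S_simplex_bounds(1) [OF assms(2)]
    by (intro convex_sum convex_convex_hull hull_inc)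
      (auto simp: one_inner simp flip: sum_divide_distrib)
  moreover have "(\<Sum>i\<in>UNIV. (z $ i / real r) *\<^sub>R corner r i) = z"
    using \<open>r > 0\<close> basis_expansion [of z] by (simp add: corner_def scalar_mult_eq_scaleR)
  ultimately show ?thesis
    by (simp add: A_simplex_eq)
qed

lemma normalized_volume_S_simplex:
  "normalized_volume (S_simplex r :: (real ^ 'd) set) = real r ^ CARD('d)"
proof -
  have "insert 0 (range (corner r)) = (\<lambda>x. real r *\<^sub>R x) ` insert 0 (Basis :: (real ^ 'd) set)"
    by (auto simp: corner_def Basis_eq_range_axis)
  then have "S_simplex r = (\<lambda>x. real r *\<^sub>R x + 0) ` (convex hull (insert 0 (Basis :: (real ^ 'd) set)))"
    by (simp only: S_simplex_eq convex_hull_scaling add_0_right)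
  moreover have "compact (convex hull (insert 0 (Basis :: (real ^ 'd) set)))"
    by (intro finite_imp_compact_convex_hull) simp
  ultimately show ?thesis
    unfolding normalized_volume_def
    by (simp only: measure_lebesgue_affine) (simp add: borel_compact content_std_simplex)
qed

section \<open>Normalized volumes of pyramids over \<open>A(r)\<close>\<close>

text \<open>
  Moving the apex of \<open>S(r)\<close> from the origin, which has height \<open>r\<close>, to \<open>x\<close> scales the normalized volume \<open>r ^ d\<close>
  by \<open>height(x) / r\<close>.
\<close>

lemma normalized_volume_pyramid_over_A:
  fixes x :: "real ^ 'd"
  assumes "r > 0" and x: "1 \<bullet> x \<le> real r"
  shows "normalized_volume (convex hull (insert x (range (corner r))))
    = (real r - 1 \<bullet> x) * real r ^ (CARD('d) - 1)"
proof -
  have "normalized_volume (convex hull (insert x (range (corner r))))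
    = \<bar>(1 \<bullet> x - real r) / (1 \<bullet> (0 :: real ^ 'd) - real r)\<bar> * normalized_volume (S_simplex r :: (real ^ 'd) set)"
    unfolding normalized_volume_def S_simplex_eq
    using \<open>r > 0\<close>
    by (subst measure_pyramid_move_apex [of "range (corner r)" 1 "real r" 0 x]) auto
  also have "\<dots> = (real r - 1 \<bullet> x) / real r * real r ^ CARD('d)"
    using x by (simp add: normalized_volume_S_simplex)
  also have "\<dots> = (real r - 1 \<bullet> x) * real r ^ (CARD('d) - 1)"
    using \<open>r > 0\<close> by (simp add: power_eq_if [of _ "CARD('d)"])
  finally show ?thesis .
qed

lemma normalized_volume_mono:
  assumes "compact S" "compact T" "S \<subseteq> T"
  shows "normalized_volume S \<le> normalized_volume T"
  unfolding normalized_volume_def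
  using assms by (intro mult_left_mono measure_mono_fmeasurable lmeasurable_compact fmeasurableD) auto

text \<open>
  The facet of the pyramid with apex \<open>x\<close> that omits the corner \<open>r e\<^sub>i\<close> is spanned by \<open>F\<close>.  Since
  \<open>x\<close> has height \<open>1\<close>, the function \<open>z\<^sub>i - x\<^sub>i * height(z)\<close> vanishes on \<open>F\<close>; it is positive at the omitted
  corner, with value \<open>r\<close>, and negative at \<open>y\<close>, with value \<open>y\<^sub>i - x\<^sub>i\<close>.  Hence the simplex spanned by \<open>F\<close>
  and \<open>y\<close> lies on the other side of \<open>F\<close>, and the ratio of the two volumes is \<open>(x\<^sub>i - y\<^sub>i) / r\<close>.
\<close>

lemma normalized_volume_ge_two_points_at_height_one:
  fixes x y :: "real ^ 'd"
  assumes "r > 0" and x: "1 \<bullet> x = real r - 1" and y: "1 \<bullet> y = real r - 1"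
    and yx: "y $ i < x $ i" and card: "CARD('d) \<ge> 2"
    and P: "compact P" "convex P" "range (corner r) \<subseteq> P" "x \<in> P" "y \<in> P"
  shows "normalized_volume P \<ge> real r ^ (CARD('d) - 1) + (x $ i - y $ i) * real r ^ (CARD('d) - 2)"
proof -
  define F where "F = insert x (corner r ` (UNIV - {i}))"
  \<comment> \<open>\<open>v \<bullet> z - c\<close> is \<open>z\<^sub>i - x\<^sub>i * height(z)\<close>\<close>
  define v where "v = axis i 1 + (x $ i) *\<^sub>R (1 :: real ^ 'd)"
  define c where "c = x $ i * real r"
  have v: "v \<bullet> z = z $ i + x $ i * (1 \<bullet> z)" for z
    by (simp add: v_def inner_add_left inner_axis')
  have F: "v \<bullet> z = c" if "z \<in> F" for z
    using that unfolding F_def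
  proof
    assume "z = x"
    then show ?thesis
      by (simp add: v c_def x right_diff_distrib)
  next
    assume "z \<in> corner r ` (UNIV - {i})"
    then obtain j where "z = corner r j" "j \<noteq> i"
      by blast
    then show ?thesis
      by (simp add: v c_def) (simp add: corner_def axis_def)
  qed
  have a: "v \<bullet> corner r i - c = real r"
    by (simp add: v c_def) (simp add: corner_def)
  have b: "v \<bullet> y - c = - (x $ i - y $ i)"
    by (simp add: v c_def y right_diff_distrib)
  \<comment> \<open>The pyramid over \<open>A(r)\<close> with apex \<open>x\<close> is also a pyramid over \<open>F\<close> with apex \<open>r e\<^sub>i\<close>.\<close>
  have T1: "insert (corner r i) F = insert x (range (corner r))"
    by (auto simp: F_def)
  have fin: "finite F"
    by (simp add: F_def)
  have vol_T1: "normalized_volume (convex hull (insert (corner r i) F)) = real r ^ (CARD('d) - 1)"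
    unfolding T1 using \<open>r > 0\<close> by (simp add: normalized_volume_pyramid_over_A x)
  have "CARD('d) - 1 = Suc (CARD('d) - 2)"
    using card by simp
  then have "real r ^ (CARD('d) - 1) = real r * real r ^ (CARD('d) - 2)"
    by simp
  moreover have "normalized_volume (convex hull (insert y F))
      = (x $ i - y $ i) / real r * normalized_volume (convex hull (insert (corner r i) F))"
    using measure_pyramid_move_apex [OF fin F, of "corner r i" y] a b \<open>r > 0\<close> yx
    by (simp add: normalized_volume_def)
  ultimately have vol_T2: "normalized_volume (convex hull (insert y F))
      = (x $ i - y $ i) * real r ^ (CARD('d) - 2)"
    using \<open>r > 0\<close> by (simp add: vol_T1)
  have "v \<bullet> corner r i > c" "v \<bullet> y < c"
    using a b \<open>r > 0\<close> yx by linarith+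
  then have "normalized_volume (convex hull (insert (corner r i) F) \<union> convex hull (insert y F))
      = normalized_volume (convex hull (insert (corner r i) F)) + normalized_volume (convex hull (insert y F))"
    unfolding normalized_volume_def distrib_left [symmetric]
    by (subst measure_pyramids_on_opposite_sides [OF fin F]) auto
  moreover have "normalized_volume (convex hull (insert (corner r i) F) \<union> convex hull (insert y F))
      \<le> normalized_volume P"
    using P fin
    by (intro normalized_volume_mono compact_Un finite_imp_compact_convex_hull Un_least hull_minimal)
      (auto simp: F_def)
  ultimately show ?thesis
    by (simp only: vol_T1 vol_T2)
qed

section \<open>The gap in the volume spectrum\<close>

lemma inner_one_Ints: "1 \<bullet> z \<in> \<int>" if "z \<in> integer_lattice"
  using that by (auto simp: one_inner integer_lattice_def intro: Ints_sum)

theorem theorem6p1: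
  fixes r :: nat and P :: "(real ^ 'd) set"
  assumes "CARD('d) \<ge> 3"
    and "r \<ge> 1"
    and "P \<in> polytopes_between r"
  shows "normalized_volume P
    \<notin> {real r ^ (CARD('d) - 1) + 1 .. real r ^ (CARD('d) - 1) + real r ^ (CARD('d) - 2) - 1}"
proof -
  define V where "V = {x. x extreme_point_of P}"
  have r: "r > 0" "real r \<ge> 1"
    using assms(2) by auto
  have "polytope P" and AP: "A_simplex r \<subseteq> P" and PS: "P \<subseteq> S_simplex r" and lattice: "V \<subseteq> integer_lattice"
    using assms(3) by (auto simp: polytopes_between_def lattice_polytope_def V_def)
  then have compact: "compact P" and convex: "convex P"
    by (auto simp: polytope_imp_compact polytope_imp_convex)
  have P_eq: "P = convex hull V"
    unfolding V_def using compact convex by (rule Krein_Milman_Minkowski)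
  have VP: "V \<subseteq> P"
    by (auto simp: V_def extreme_point_of_def)
  have corners: "range (corner r) \<subseteq> P"
    using AP hull_subset by (force simp: A_simplex_eq)
  have height: "1 \<bullet> x = real r \<or> 1 \<bullet> x = real r - 1 \<or> 1 \<bullet> x \<le> real r - 2" if "x \<in> V" for x
  proof -
    have "1 \<bullet> x \<in> \<int>"
      using lattice that by (intro inner_one_Ints) auto
    then obtain k where k: "1 \<bullet> x = of_int k"
      by (elim Ints_cases)
    have "1 \<bullet> x \<le> real r"
      using that VP PS S_simplex_bounds(2) by blast
    then have "k = int r \<or> k = int r - 1 \<or> k \<le> int r - 2"
      unfolding k by linarith
    then show ?thesis
      unfolding k by auto
  qed
  \<comment> \<open>Case \<open>one\<close> includes \<open>P = A(r)\<close>, where \<open>x\<close> is any vertex and the pyramid is flat.\<close>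
  consider (deep) x where "x \<in> V" "1 \<bullet> x \<le> real r - 2"
    | (two) x y where "x \<in> V" "y \<in> V" "x \<noteq> y" "1 \<bullet> x = real r - 1" "1 \<bullet> y = real r - 1"
    | (one) x where "x \<in> V" "real r - 1 \<le> 1 \<bullet> x" "\<And>y. y \<in> V \<Longrightarrow> y \<noteq> x \<Longrightarrow> 1 \<bullet> y = real r"
  proof -
    have "V \<noteq> {}"
      using corners P_eq by auto
    then obtain z where z: "z \<in> V"
      by blast
    show ?thesis
    proof (cases "\<exists>x\<in>V. 1 \<bullet> x = real r - 1")
      case True
      then obtain x where x: "x \<in> V" "1 \<bullet> x = real r - 1"
        by blast
      show ?thesis
      proof (cases "\<forall>y\<in>V. y \<noteq> x \<longrightarrow> 1 \<bullet> y = real r")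
        case True
        with x one show ?thesis
          by simp
      next
        case False
        then obtain y where "y \<in> V" "y \<noteq> x" "1 \<bullet> y \<noteq> real r"
          by blast
        with x height [of y] deep [of y] two [of x y] show ?thesis
          by auto
      qed
    next
      case False
      with z height deep one [of z] show ?thesis
        by fastforce
    qed
  qed
  then show ?thesis
  proof cases
    case deep
    have "normalized_volume P \<ge> normalized_volume (convex hull (insert x (range (corner r))))"
      using deep VP corners compact convex
      by (intro normalized_volume_mono finite_imp_compact_convex_hull hull_minimal) auto
    also have "normalized_volume (convex hull (insert x (range (corner r))))
      = (real r - 1 \<bullet> x) * real r ^ (CARD('d) - 1)"
      using deep r by (simp add: normalized_volume_pyramid_over_A)
    finally have "normalized_volume P \<ge> 2 * real r ^ (CARD('d) - 1)"
      using deep(2) mult_right_mono [of 2 "real r - 1 \<bullet> x" "real r ^ (CARD('d) - 1)"] by simp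
    moreover have "real r ^ (CARD('d) - 2) \<le> real r ^ (CARD('d) - 1)"
      using r by (intro power_increasing) auto
    ultimately show ?thesis
      by simp
  next
    case two
    have "\<exists>i. y $ i < x $ i"
    proof (rule ccontr)
      assume "\<nexists>i. y $ i < x $ i"
      then have le: "x $ i \<le> y $ i" for i
        by (simp add: not_less)
      have "(\<Sum>i\<in>UNIV. x $ i) = (\<Sum>i\<in>UNIV. y $ i)"
        using two by (simp add: one_inner)
      then have "x $ i = y $ i" for i
        by (rule sum_mono_inv) (simp_all add: le)
      then have "x = y"
        by (simp add: vec_eq_iff)
      with two show False by simp
    qed
    then obtain i where i: "y $ i < x $ i" ..
    have "x $ i - y $ i \<in> \<int>"
      using two lattice unfolding integer_lattice_def by (intro Ints_diff) auto
    with i have "1 \<le> x $ i - y $ i"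
      by (auto elim!: Ints_cases)
    then have "real r ^ (CARD('d) - 2) \<le> (x $ i - y $ i) * real r ^ (CARD('d) - 2)"
      by (simp add: mult_le_cancel_right1)
    moreover have "normalized_volume P
        \<ge> real r ^ (CARD('d) - 1) + (x $ i - y $ i) * real r ^ (CARD('d) - 2)"
      using two i r assms(1) VP corners compact convex
      by (intro normalized_volume_ge_two_points_at_height_one) auto
    ultimately show ?thesis
      by simp
  next
    case one
    have "V \<subseteq> convex hull (insert x (range (corner r)))"
    proof
      fix y
      assume "y \<in> V"
      show "y \<in> convex hull (insert x (range (corner r)))"
      proof (cases "y = x")
        case True
        then show ?thesis by (simp add: hull_inc)
      next
        case False
        then have "y \<in> A_simplex r"
          using \<open>y \<in> V\<close> one VP PS r by (intro A_simplex_memI) auto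
        then show ?thesis
          unfolding A_simplex_eq using hull_mono [of "range (corner r)"] by blast
      qed
    qed
    then have "P \<subseteq> convex hull (insert x (range (corner r)))"
      unfolding P_eq by (simp add: hull_minimal)
    then have "normalized_volume P \<le> normalized_volume (convex hull (insert x (range (corner r))))"
      using compact by (intro normalized_volume_mono finite_imp_compact_convex_hull) auto
    also have "\<dots> = (real r - 1 \<bullet> x) * real r ^ (CARD('d) - 1)"
      using height [OF one(1)] r by (intro normalized_volume_pyramid_over_A) auto
    also have "\<dots> \<le> 1 * real r ^ (CARD('d) - 1)"
      using one by (intro mult_right_mono) auto
    finally show ?thesis
      by simp
  qed
qed

end
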